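(* Let $k,t \geq 2$ be coprime integers. Then the following hold: (1) If $1 \leq r \leq t - k$, then $r \succ_{k,t} r+k$. (2) If $1 \leq r \leq y \leq t$ and $r < s \leq t$, then for $k \geq y(y+1)$, $r \succ_{k,t} s$. In particular (case $y=1$), $1 \succ_{k,t} s$ for all $2\le s\le t$. (3) If $k \geq \frac{6(t^2-1)}{\pi^2}$, then for all $1 \leq r < s \leq t$ we have $r \succ_{k,t} s$. (4) If $k = mt - 1$ for some integer $m \geq 1$ and $k \leq \left(\frac{\pi^2}{6} + \frac{5}{2t}\right)^{-1}(t^2 - 1)$, then $t \succ_{k,t} t - 1$. (5) If $t > 2$, then $\mathscr{O}(t) \geq \frac{\varphi(t)}{2}$, where $\varphi$ is Euler's totient function.
   Context: A partition of $n$ is $k$-indivisible if none of its parts is divisible by $k$. $D_k^\times(r,t;n)$ denotes the total number of parts congruent to $r$ modulo $t$, counted with multiplicity over all $k$-indivisible partitions of $n$. For $1 \le r,s\le t$, write $r \succ_{k,t} s$ (resp. $r\prec_{k,t} s$) if $D_k^\times(r,t;n) > D_k^\times(s,t;n)$ (resp. $<$) for all sufficiently large $n$. $\mathscr{O}(t)$ denotes the number of distinct orderings of $\{1,\dots,t\}$ induced by $\prec_{k,t}$ as $k$ ranges over all integers $k\ge 2$ with $\gcd(k,t)=1$. *)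

theory Defs
  imports "HOL-Analysis.Analysis" "HOL-Library.Multiset" "HOL-Number_Theory.Number_Theory"
begin

definition partitions :: "nat \<Rightarrow> nat multiset set" where
  "partitions n = {M. (\<forall>x\<in>#M. 0 < x) \<and> sum_mset M = n}"

definition indivisible :: "nat \<Rightarrow> nat multiset \<Rightarrow> bool" where
  "indivisible k M \<longleftrightarrow> (\<forall>x\<in>#M. \<not> k dvd x)"

definition Dx :: "nat \<Rightarrow> nat \<Rightarrow> nat \<Rightarrow> nat \<Rightarrow> nat" where
  "Dx k r t n = (\<Sum>M\<in>{M\<in>partitions n. indivisible k M}.
                    size (filter_mset (\<lambda>x. [x = r] (mod t)) M))"

definition succ_kt :: "nat \<Rightarrow> nat \<Rightarrow> nat \<Rightarrow> nat \<Rightarrow> bool" where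
  "succ_kt k t r s \<longleftrightarrow> (\<forall>\<^sub>F n in sequentially. Dx k s t n < Dx k r t n)"

definition prec_kt :: "nat \<Rightarrow> nat \<Rightarrow> nat \<Rightarrow> nat \<Rightarrow> bool" where
  "prec_kt k t r s \<longleftrightarrow> (\<forall>\<^sub>F n in sequentially. Dx k r t n < Dx k s t n)"

definition ordering_kt :: "nat \<Rightarrow> nat \<Rightarrow> (nat \<times> nat) set" where
  "ordering_kt k t = {(r, s). r \<in> {1..t} \<and> s \<in> {1..t} \<and> prec_kt k t r s}"

definition num_orderings :: "nat \<Rightarrow> nat" where
  "num_orderings t = card {ordering_kt k t | k. 2 \<le> k \<and> coprime k t}"

end

theory Submission
  imports Defs
begin

text \<open>
  Let \<open>p n\<close> count the \<open>k\<close>-indivisible partitions of \<open>n\<close>. The difference of the counts for \<open>r\<close> and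
  \<open>s\<close> is the sum over \<open>j\<close> and \<open>m\<close> of \<open>c m * p (n - j * m)\<close>, where \<open>c m\<close> is the signed indicator
  of the \<open>m\<close> not divisible by \<open>k\<close> that are congruent to \<open>r\<close> or \<open>s\<close> modulo \<open>t\<close>. Since \<open>p\<close>
  is monotone, \<open>c\<close> is periodic with mean zero, and \<open>p n\<close> is negligible against
  \<open>P n = p 0 + ... + p (n - 1)\<close>, the difference is \<open>(S + o(1)) * P n\<close> with \<open>S\<close> the conditionally
  convergent sum of \<open>c m / m\<close>. Splitting off the multiples of \<open>k\<close>
  expresses \<open>S\<close> through the digamma function at \<open>r / t\<close>, \<open>s / t\<close> and at the quotients
  \<open>r' / t\<close>, \<open>s' / t\<close>, where \<open>k * r'\<close> is congruent to \<open>r\<close> and \<open>k * s'\<close> to \<open>s\<close> modulo \<open>t\<close>, and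
  every claim becomes an inequality between digamma differences.
\<close>

subsection \<open>Growth of the number of indivisible partitions\<close>

definition regular :: "nat \<Rightarrow> nat \<Rightarrow> nat multiset set" where
  "regular k n = {M \<in> partitions n. indivisible k M}"

definition num_regular :: "nat \<Rightarrow> nat \<Rightarrow> nat" where
  "num_regular k n = card (regular k n)"

lemma regular_iff:
  "M \<in> regular k n \<longleftrightarrow> (\<forall>x\<in>#M. 0 < x \<and> \<not> k dvd x) \<and> sum_mset M = n"
  by (auto simp: regular_def partitions_def indivisible_def)

lemma member_le_sum_mset_nat: "x \<in># M \<Longrightarrow> x \<le> sum_mset (M :: nat multiset)"
  by (drule multi_member_split) auto

lemma size_le_sum_mset_nat:
  assumes "\<forall>x\<in>#M. 0 < (x::nat)"
  shows "size M \<le> sum_mset M"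
  using assms by (induction M) (auto simp: Suc_le_eq add_strict_increasing)

lemma count_mult_le_sum_mset_nat: "count M x * x \<le> sum_mset (M :: nat multiset)"
proof -
  have "replicate_mset (count M x) x \<subseteq># M"
    by (simp flip: count_le_replicate_mset_subset_eq)
  then obtain N where "M = replicate_mset (count M x) x + N"
    by (metis mset_subset_eq_exists_conv)
  then have "sum_mset M = count M x * x + sum_mset N"
    by (metis sum_mset.union sum_mset_replicate_mset of_nat_id)
  then show ?thesis by simp
qed

lemma finite_regular [simp]: "finite (regular k n)"
proof (rule finite_subset)
  show "regular k n \<subseteq> mset ` {xs. set xs \<subseteq> {..n} \<and> length xs \<le> n}"
  proof
    fix M assume M: "M \<in> regular k n"
    obtain xs where xs: "M = mset xs" by (metis ex_mset)
    have "set xs \<subseteq> {..n}"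
      using M member_le_sum_mset_nat[of _ M] by (auto simp: regular_iff xs)
    moreover have "length xs \<le> n"
      using M size_le_sum_mset_nat[of M] by (auto simp: regular_iff xs)
    ultimately show "M \<in> mset ` {xs. set xs \<subseteq> {..n} \<and> length xs \<le> n}"
      using xs by blast
  qed
qed (intro finite_imageI finite_lists_length_le finite_atMost)

text \<open>Since \<open>k\<close> exceeds 1, the part 1 is always allowed, and adding it injects
  the partitions of \<open>i\<close> into those of \<open>Suc i\<close>.\<close>

lemma num_regular_mono:
  assumes "2 \<le> k" "m \<le> n"
  shows "num_regular k m \<le> num_regular k n"
proof -
  have "num_regular k i \<le> num_regular k (Suc i)" for i
    unfolding num_regular_def
  proof (rule card_inj_on_le)
    show "add_mset 1 ` regular k i \<subseteq> regular k (Suc i)"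
      using assms(1) by (auto simp: regular_iff)
  qed (auto simp: inj_on_def)
  then show ?thesis using assms(2) by (metis lift_Suc_mono_le)
qed

text \<open>The left side counts pairs of a partition and one of its distinct parts
  \<open>a\<close>. Deleting one copy of \<open>a\<close> leaves a partition of
  \<open>n - a\<close>, whose size reveals \<open>a\<close> and hence the pair.\<close>

lemma sum_distinct_parts_le:
  "(\<Sum>M\<in>regular k n. card (set_mset M)) \<le> (\<Sum>i<n. num_regular k i)"
proof -
  let ?f = "\<lambda>(M, a). M - {#a#}"
  have "(\<Sum>M\<in>regular k n. card (set_mset M)) = card (Sigma (regular k n) set_mset)"
    by (simp add: card_SigmaI)
  also have "\<dots> \<le> card (\<Union>i<n. regular k i)"
  proof (rule card_inj_on_le)
    show "inj_on ?f (Sigma (regular k n) set_mset)"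
    proof (rule inj_onI, clarify)
      fix M a N b
      assume M: "M \<in> regular k n" "a \<in># M" and N: "N \<in> regular k n" "b \<in># N"
        and eq: "M - {#a#} = N - {#b#}"
      have "sum_mset M = a + sum_mset (M - {#a#})" "sum_mset N = b + sum_mset (N - {#b#})"
        using M N by (simp_all add: sum_mset.remove)
      then have "a = b" using M N eq by (auto simp: regular_iff)
      then show "M = N \<and> a = b" using M(2) N(2) eq by (metis insert_DiffM)
    qed
    show "?f ` Sigma (regular k n) set_mset \<subseteq> (\<Union>i<n. regular k i)"
    proof clarify
      fix M a assume M: "M \<in> regular k n" "a \<in># M"
      have "sum_mset M = a + sum_mset (M - {#a#})" using M by (simp add: sum_mset.remove)
      moreover have "0 < a" using M by (auto simp: regular_iff)
      ultimately have "sum_mset (M - {#a#}) < n" using M by (auto simp: regular_iff)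
      moreover have "M - {#a#} \<in> regular k (sum_mset (M - {#a#}))"
        using M by (auto simp: regular_iff dest: in_diffD)
      ultimately show "M - {#a#} \<in> (\<Union>i<n. regular k i)" by blast
    qed
  qed simp
  also have "\<dots> \<le> (\<Sum>i<n. num_regular k i)"
    unfolding num_regular_def by (rule card_UN_le) simp
  finally show ?thesis .
qed

text \<open>Such a partition is encoded by a list of exactly \<open>L\<close> pairs (part,
  multiplicity) with all entries at most \<open>n\<close>.\<close>

lemma card_few_distinct_parts_le:
  "card {M \<in> regular k n. card (set_mset M) < L} \<le> (n + 1) ^ (2 * L)"
proof -
  define f :: "(nat \<times> nat) list \<Rightarrow> nat multiset" where
    "f xs = (\<Sum>(a, c)\<leftarrow>xs. replicate_mset c a)" for xs
  let ?X = "{xs. set xs \<subseteq> {..n} \<times> {..n} \<and> length xs = L}"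
  have fin: "finite ?X" by (intro finite_lists_length_eq) auto
  have "{M \<in> regular k n. card (set_mset M) < L} \<subseteq> f ` ?X"
  proof clarify
    fix M assume M: "M \<in> regular k n" and L: "card (set_mset M) < L"
    obtain xs where xs: "set xs = set_mset M" "distinct xs"
      by (metis finite_distinct_list finite_set_mset)
    \<comment> \<open>The pairs \<open>(0, 0)\<close> decode to the empty multiset, so they pad the
      list to length \<open>L\<close> without effect.\<close>
    define ys where "ys = map (\<lambda>a. (a, count M a)) xs @ replicate (L - length xs) (0, 0)"
    have len: "length xs \<le> L" using L xs by (metis distinct_card less_imp_le)
    have zero: "f (replicate m (0, 0)) = {#}" for m
      by (induction m) (auto simp: f_def)
    have "f ys = f (map (\<lambda>a. (a, count M a)) xs) + f (replicate (L - length xs) (0, 0))"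
      by (simp add: f_def ys_def)
    also have "\<dots> = (\<Sum>a\<in>set_mset M. replicate_mset (count M a) a)"
      unfolding zero using xs by (simp add: f_def o_def sum_list_distinct_conv_sum_set)
    also have "\<dots> = M"
      by (rule multiset_eqI) (auto simp: count_sum sum.delta if_distrib not_in_iff cong: if_cong)
    finally have "M = f ys" ..
    moreover have "count M a \<le> n" if "a \<in># M" for a
    proof -
      have "0 < a" using M that by (auto simp: regular_iff)
      then have "count M a * 1 \<le> count M a * a" by (intro mult_le_mono) auto
      also have "\<dots> \<le> n" using M count_mult_le_sum_mset_nat[of M a] by (auto simp: regular_iff)
      finally show ?thesis by simp
    qed
    then have "ys \<in> ?X"
      using M xs len member_le_sum_mset_nat[of _ M] by (auto simp: ys_def regular_iff)
    ultimately show "M \<in> f ` ?X" by blast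
  qed
  then have "card {M \<in> regular k n. card (set_mset M) < L} \<le> card (f ` ?X)"
    by (intro card_mono finite_imageI fin)
  also have "\<dots> \<le> card ?X" by (rule card_image_le[OF fin])
  also have "\<dots> = card ({..n} \<times> {..n}) ^ L" by (rule card_lists_length_eq) auto
  also have "\<dots> = (n + 1) ^ (2 * L)"
    by (simp add: card_cartesian_product power_mult power2_eq_square)
  finally show ?thesis .
qed

text \<open>The parts \<open>i * k + 1\<close> are prime to \<open>k\<close>. Multiplicities up to
  \<open>n div A R\<close> can be chosen freely for \<open>R\<close> of them, and parts 1 fill up
  the rest. Starting at \<open>i = 1\<close> keeps these parts distinct from the filler. As
  \<open>R\<close> is arbitrary, growth beats every polynomial.\<close>

lemma num_regular_ge_power:
  assumes k: "2 \<le> k"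
  defines "A \<equiv> \<lambda>R. \<Sum>i=1..R. i * k + 1"
  shows "(n div A R + 1) ^ R \<le> num_regular k n"
proof -
  define N where "N = n div A R"
  define g where "g f = (\<Sum>i=1..R. replicate_mset (f i) (i * k + 1))
    + replicate_mset (n - (\<Sum>i=1..R. f i * (i * k + 1))) 1" for f :: "nat \<Rightarrow> nat"
  let ?X = "{1..R} \<rightarrow>\<^sub>E {..N}"
  have cnt: "count (g f) (j * k + 1) = f j" if "j \<in> {1..R}" for f j
  proof -
    have "count (g f) (j * k + 1) = (\<Sum>i=1..R. if j = i then f i else 0)"
      unfolding g_def using that k by (auto simp: count_sum intro!: sum.cong)
    also have "\<dots> = f j" using that by (simp add: sum.delta)
    finally show ?thesis .
  qed
  have "card ?X \<le> card (regular k n)"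
  proof (rule card_inj_on_le)
    show "inj_on g ?X"
    proof (rule inj_onI)
      fix f f' assume f: "f \<in> ?X" "f' \<in> ?X" and "g f = g f'"
      then have "f j = f' j" if "j \<in> {1..R}" for j
        using cnt[OF that, of f] cnt[OF that, of f'] by simp
      with f show "f = f'" by (metis PiE_ext)
    qed
    show "g ` ?X \<subseteq> regular k n"
    proof (rule image_subsetI)
      fix f assume f: "f \<in> ?X"
      have "(\<Sum>i=1..R. f i * (i * k + 1)) \<le> (\<Sum>i=1..R. N * (i * k + 1))"
        using f by (intro sum_mono mult_le_mono) (auto simp: PiE_iff)
      also have "\<dots> = N * A R" unfolding A_def by (rule sum_distrib_left [symmetric])
      also have "\<dots> \<le> n" by (simp add: N_def)
      finally have "(\<Sum>i=1..R. f i * (i * k + 1)) \<le> n" .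
      moreover have "sum_mset (\<Sum>i\<in>I. replicate_mset (f i) (i * k + 1)) = (\<Sum>i\<in>I. f i * (i * k + 1))"
        if "finite I" for I
        using that by (induction I rule: finite_induct) auto
      ultimately have "sum_mset (g f) = n" unfolding g_def by simp
      moreover have "\<not> k dvd i * k + 1" for i
        using k by (metis dvd_add_right_iff dvd_triv_right nat_dvd_1_iff_1 numeral_le_one_iff semiring_norm(69))
      ultimately show "g f \<in> regular k n"
        using k by (auto simp: regular_iff g_def set_mset_sum split: if_splits)
    qed
  qed simp
  then show ?thesis by (simp add: card_PiE N_def num_regular_def)
qed

text \<open>
  Removing one copy of a part is injective on pairs (partition, distinct part), while the
  partitions with few distinct parts are outnumbered by the superpolynomial growth.
\<close>
lemma num_regular_small:
  assumes k: "2 \<le> k"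
  shows "\<forall>\<^sub>F n in sequentially. L * num_regular k n \<le> (\<Sum>i<n. num_regular k i)"
proof -
  \<comment> \<open>The one surplus copy of \<open>num_regular k n\<close> pays for the partitions
    with fewer than \<open>L'\<close> distinct parts.\<close>
  define L' where "L' = Suc L"
  \<comment> \<open>The exponent exceeds by one the exponent \<open>2 * L'\<close> that bounds the
    partitions with few distinct parts. The spare factor \<open>n + 1\<close> absorbs the constant
    \<open>L' * A ^ R\<close>.\<close>
  define R where "R = 2 * L' + 1"
  define A where "A = (\<Sum>i=1..R. i * k + 1)"
  have A: "0 < A" by (simp add: A_def R_def)
  show ?thesis
  proof (rule eventually_sequentiallyI)
    fix n assume n: "L' * A ^ R \<le> n"
    let ?F = "{M \<in> regular k n. card (set_mset M) < L'}"
    have "n + 1 \<le> A * (n div A + 1)"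
      using A dividend_less_times_div[of A n] by simp
    then have "(n + 1) ^ R \<le> (A * (n div A + 1)) ^ R" by (rule power_mono) simp
    also have "\<dots> \<le> A ^ R * num_regular k n"
      unfolding power_mult_distrib
      using num_regular_ge_power[OF k, of n R] by (intro mult_left_mono) (simp_all add: A_def)
    finally have "(n + 1) * (n + 1) ^ (2 * L') \<le> A ^ R * num_regular k n"
      by (simp add: R_def)
    moreover have "L' * A ^ R * (n + 1) ^ (2 * L') \<le> (n + 1) * (n + 1) ^ (2 * L')"
      using n by (intro mult_le_mono) auto
    ultimately have "A ^ R * (L' * (n + 1) ^ (2 * L')) \<le> A ^ R * num_regular k n"
      by (simp only: mult_ac)
    then have "L' * (n + 1) ^ (2 * L') \<le> num_regular k n"
      using nat_mult_le_cancel1[OF zero_less_power[OF A]] by blast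
    then have F: "L' * card ?F \<le> num_regular k n"
      by (rule order_trans[OF mult_le_mono2[OF card_few_distinct_parts_le]])
    have "num_regular k n = card (regular k n - ?F) + card ?F"
      using card_Diff_subset[of ?F "regular k n"] card_mono[of "regular k n" ?F]
      by (simp add: num_regular_def)
    then have split: "L' * num_regular k n = L' * card (regular k n - ?F) + L' * card ?F"
      by (simp only: distrib_left)
    have "L' * card (regular k n - ?F) \<le> (\<Sum>M\<in>regular k n - ?F. card (set_mset M))"
    proof -
      have "of_nat (card (regular k n - ?F)) * L' \<le> (\<Sum>M\<in>regular k n - ?F. card (set_mset M))"
        by (rule sum_bounded_below) auto
      then show ?thesis by (simp only: mult.commute of_nat_id)
    qed
    also have "\<dots> \<le> (\<Sum>M\<in>regular k n. card (set_mset M))"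
      by (intro sum_mono2) auto
    also have "\<dots> \<le> (\<Sum>i<n. num_regular k i)" by (rule sum_distinct_parts_le)
    finally have "L' * card (regular k n - ?F) \<le> (\<Sum>i<n. num_regular k i)" .
    moreover have "L' * num_regular k n = num_regular k n + L * num_regular k n"
      by (simp add: L'_def)
    ultimately show "L * num_regular k n \<le> (\<Sum>i<n. num_regular k i)"
      using F split by linarith
  qed
qed

subsection \<open>Counting parts by Abel summation\<close>

text \<open>Removing \<open>j\<close> copies of \<open>m\<close> is a bijection onto the partitions
  of \<open>n - j * m\<close>; its inverse stays \<open>k\<close>-indivisible because
  \<open>k\<close> does not divide \<open>m\<close>.\<close>

lemma card_regular_count_ge:
  assumes "0 < m" "\<not> k dvd m"
  shows "card {M \<in> regular k n. j \<le> count M m}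
    = (if j * m \<le> n then num_regular k (n - j * m) else 0)"
proof (cases "j * m \<le> n")
  case True
  have "bij_betw (\<lambda>M. M + replicate_mset j m) (regular k (n - j * m))
      {M \<in> regular k n. j \<le> count M m}"
  proof (rule bij_betw_byWitness[where f' = "\<lambda>M. M - replicate_mset j m"])
    show "\<forall>M\<in>{M \<in> regular k n. j \<le> count M m}. M - replicate_mset j m + replicate_mset j m = M"
      by (auto simp: count_le_replicate_mset_subset_eq)
    show "(\<lambda>M. M + replicate_mset j m) ` regular k (n - j * m) \<subseteq> {M \<in> regular k n. j \<le> count M m}"
      using True assms by (auto simp: regular_iff split: if_splits)
    show "(\<lambda>M. M - replicate_mset j m) ` {M \<in> regular k n. j \<le> count M m} \<subseteq> regular k (n - j * m)"
    proof clarify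
      fix M assume M: "M \<in> regular k n" "j \<le> count M m"
      then obtain N where N: "M = replicate_mset j m + N"
        by (metis count_le_replicate_mset_subset_eq mset_subset_eq_exists_conv)
      show "M - replicate_mset j m \<in> regular k (n - j * m)"
        using M(1) unfolding N by (auto simp: regular_iff)
    qed
  qed auto
  then show ?thesis using True by (metis bij_betw_same_card num_regular_def)
next
  case False
  have "\<not> j \<le> count M m" if "M \<in> regular k n" for M
  proof
    assume "j \<le> count M m"
    then have "j * m \<le> count M m * m" by simp
    also have "\<dots> \<le> n" using count_mult_le_sum_mset_nat[of M m] that by (simp add: regular_iff)
    finally show False using False by simp
  qed
  then have "{M \<in> regular k n. j \<le> count M m} = {}" by blast
  then show ?thesis using False by simp
qed

text \<open>Truncated subtraction would give the value for the empty partition beyond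
  \<open>n\<close>. The explicit 0 there makes this a function of \<open>i\<close> that decreases to
  zero for \<open>k \<ge> 2\<close>.\<close>

definition num_regular_diff :: "nat \<Rightarrow> nat \<Rightarrow> nat \<Rightarrow> nat" where
  "num_regular_diff k n i = (if i \<le> n then num_regular k (n - i) else 0)"

text \<open>The multiplicity of \<open>m\<close> is the number of \<open>j \<ge> 1\<close> with at
  least \<open>j\<close> copies of \<open>m\<close>; exchanging the sums then counts partitions
  containing \<open>j\<close> copies. The index is shifted, hence \<open>Suc j\<close>.\<close>

lemma Dx_eq:
  "Dx k r t n = (\<Sum>j<n. \<Sum>m=1..n. of_bool ([m = r] (mod t) \<and> \<not> k dvd m)
    * num_regular_diff k n (Suc j * m))"
proof -
  let ?A = "{m \<in> {1..n}. [m = r] (mod t) \<and> \<not> k dvd m}"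
  have size: "size (filter_mset (\<lambda>x. [x = r] (mod t)) M)
      = (\<Sum>m\<in>?A. \<Sum>j<n. of_bool (Suc j \<le> count M m))" if M: "M \<in> regular k n" for M
  proof -
    have "size (filter_mset (\<lambda>x. [x = r] (mod t)) M)
        = (\<Sum>m\<in>{x \<in> set_mset M. [x = r] (mod t)}. count M m)"
      unfolding size_multiset_overloaded_eq by (intro sum.cong) auto
    also have "\<dots> = (\<Sum>m\<in>?A. count M m)"
      using M member_le_sum_mset_nat[of _ M]
      by (intro sum.mono_neutral_left) (auto simp: regular_iff Suc_le_eq not_in_iff)
    also have "\<dots> = (\<Sum>m\<in>?A. \<Sum>j<n. of_bool (Suc j \<le> count M m))"
    proof (rule sum.cong[OF refl])
      fix m assume m: "m \<in> ?A"
      then have "count M m * 1 \<le> count M m * m" by (intro mult_le_mono) auto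
      also have "\<dots> \<le> n" using count_mult_le_sum_mset_nat[of M m] M by (simp add: regular_iff)
      finally have "{..<n} \<inter> {j. Suc j \<le> count M m} = {..<count M m}" by auto
      then show "count M m = (\<Sum>j<n. of_bool (Suc j \<le> count M m))"
        by (simp add: sum_of_bool_eq)
    qed
    finally show ?thesis .
  qed
  have "Dx k r t n = (\<Sum>M\<in>regular k n. \<Sum>m\<in>?A. \<Sum>j<n. of_bool (Suc j \<le> count M m))"
    unfolding Dx_def regular_def[symmetric] by (intro sum.cong size refl)
  also have "\<dots> = (\<Sum>m\<in>?A. \<Sum>j<n. \<Sum>M\<in>regular k n. of_bool (Suc j \<le> count M m))"
    by (subst sum.swap, intro sum.cong refl, rule sum.swap)
  also have "\<dots> = (\<Sum>m\<in>?A. \<Sum>j<n. num_regular_diff k n (Suc j * m))"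
  proof (intro sum.cong refl)
    fix m j assume m: "m \<in> ?A"
    have "(\<Sum>M\<in>regular k n. of_bool (Suc j \<le> count M m))
        = card {M \<in> regular k n. Suc j \<le> count M m}"
      by (simp add: sum_of_bool_eq Int_def)
    then show "(\<Sum>M\<in>regular k n. of_bool (Suc j \<le> count M m))
        = num_regular_diff k n (Suc j * m)"
      using m by (simp add: card_regular_count_ge num_regular_diff_def del: mult_Suc)
  qed
  also have "\<dots> = (\<Sum>m=1..n. of_bool ([m = r] (mod t) \<and> \<not> k dvd m)
      * (\<Sum>j<n. num_regular_diff k n (Suc j * m)))"
    by (intro sum.mono_neutral_cong_left) auto
  also have "\<dots> = (\<Sum>j<n. \<Sum>m=1..n. of_bool ([m = r] (mod t) \<and> \<not> k dvd m)
      * num_regular_diff k n (Suc j * m))"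
    unfolding sum_distrib_left by (rule sum.swap)
  finally show ?thesis .
qed

text \<open>Summation by parts replaces \<open>c\<close> by its bounded partial sums, and the
  decrements of \<open>g\<close> telescope.\<close>

lemma Abel_summation_bound:
  fixes c g :: "nat \<Rightarrow> real"
  assumes "\<And>n. \<bar>\<Sum>i<n. c i\<bar> \<le> B" "antimono g" "\<And>i. 0 \<le> g i"
  shows "\<bar>\<Sum>i<N. c i * g i\<bar> \<le> B * g 0"
proof -
  let ?C = "\<lambda>n. \<Sum>i<n. c i"
  have "(\<Sum>i<N. c i * g i) = ?C N * g N + (\<Sum>i<N. ?C (Suc i) * (g i - g (Suc i)))"
    by (induction N) (auto simp: algebra_simps)
  also have "\<bar>\<dots>\<bar> \<le> \<bar>?C N\<bar> * g N + (\<Sum>i<N. \<bar>?C (Suc i)\<bar> * (g i - g (Suc i)))"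
    using assms(2,3) by (intro abs_triangle_ineq[THEN order_trans] add_mono sum_abs[THEN order_trans] sum_mono)
      (simp_all add: abs_mult antimonoD)
  also have "\<dots> \<le> B * g N + (\<Sum>i<N. B * (g i - g (Suc i)))"
    using assms by (intro add_mono sum_mono mult_right_mono) (simp_all add: antimonoD del: sum.lessThan_Suc)
  also have "\<dots> = B * g 0"
    by (simp only: sum_distrib_left[symmetric] sum_lessThan_telescope') (simp add: algebra_simps)
  finally show ?thesis .
qed

text \<open>The indices are cut into blocks of length \<open>m\<close>, and \<open>f\<close> is
  compared with its value at a block end. Together the bounds say that the sum over multiples of
  \<open>m\<close> is the full sum divided by \<open>m\<close>, up to an error
  \<open>f 0\<close>.\<close>

lemma sum_multiples_bounds:
  fixes f :: "nat \<Rightarrow> real"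
  assumes f: "antimono f" "\<And>i. n < i \<Longrightarrow> f i = 0" and m: "1 \<le> m"
  shows "real m * (\<Sum>j<n. f (Suc j * m)) \<le> (\<Sum>i<n. f (Suc i))" (is "?L \<le> ?P")
    and "(\<Sum>i<n. f (Suc i)) \<le> real m * (f 0 + (\<Sum>j<n. f (Suc j * m)))"
proof -
  have nonneg: "0 \<le> f i" for i
    using f(2)[of "Suc n + i"] antimonoD[OF f(1), of i "Suc n + i"] by simp
  have nm: "n \<le> n * m" using m by simp
  have "?L = (\<Sum>j<n. \<Sum>i=j*m..<j*m+m. f (Suc j * m))"
    by (simp add: sum_distrib_left)
  also have "\<dots> \<le> (\<Sum>j<n. \<Sum>i=j*m..<j*m+m. f (Suc i))"
    by (intro sum_mono antimonoD[OF f(1)]) auto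
  also have "\<dots> = (\<Sum>i<n*m. f (Suc i))" by (rule sum.nat_group)
  also have "\<dots> = ?P" using f(2) nm by (intro sum.mono_neutral_right) auto
  finally show "?L \<le> ?P" .
  have "?P \<le> (\<Sum>i<n*m. f i)"
  proof -
    have "?P \<le> (\<Sum>i<n. f i)" by (intro sum_mono antimonoD[OF f(1)]) auto
    also have "\<dots> \<le> (\<Sum>i<n*m. f i)" using nm nonneg by (intro sum_mono2) auto
    finally show ?thesis .
  qed
  also have "\<dots> = (\<Sum>j<n. \<Sum>i=j*m..<j*m+m. f i)" by (rule sum.nat_group[symmetric])
  also have "\<dots> \<le> (\<Sum>j<n. \<Sum>i=j*m..<j*m+m. f (j * m))"
    by (intro sum_mono antimonoD[OF f(1)]) auto
  also have "\<dots> = real m * (\<Sum>j<n. f (j * m))" by (simp add: sum_distrib_left)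
  also have "\<dots> \<le> real m * (\<Sum>j<Suc n. f (j * m))"
    using nonneg by (intro mult_left_mono) auto
  also have "(\<Sum>j<Suc n. f (j * m)) = f 0 + (\<Sum>j<n. f (Suc j * m))"
    by (subst sum.lessThan_Suc_shift) simp
  finally show "?P \<le> real m * (f 0 + (\<Sum>j<n. f (Suc j * m)))" .
qed

text \<open>
  The small multipliers \<open>m \<le> M\<close> contribute about \<open>c m / m\<close> times the total mass of \<open>f\<close>; for the
  large ones the cancellation in \<open>c\<close> leaves only one boundary term for each \<open>j\<close>.
\<close>
lemma weighted_multiples_lower_bound:
  fixes f c :: "nat \<Rightarrow> real"
  assumes f: "antimono f" "\<And>i. n < i \<Longrightarrow> f i = 0" and M: "1 \<le> M"
    and c: "\<And>i. \<bar>c i\<bar> \<le> 1" "\<And>N. \<bar>\<Sum>i<N. c (Suc M + i)\<bar> \<le> B"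
  shows "((\<Sum>m=1..M. c m / real m) - B / real M) * (\<Sum>i<n. f (Suc i)) - real M * f 0
    \<le> (\<Sum>j<n. \<Sum>m=1..n. c m * f (Suc j * m))"
proof -
  define P where "P = (\<Sum>i<n. f (Suc i))"
  define T where "T m = (\<Sum>j<n. f (Suc j * m))" for m
  have nonneg: "0 \<le> f i" for i
    using f(2)[of "Suc n + i"] antimonoD[OF f(1), of i "Suc n + i"] by simp
  have B: "0 \<le> B" using c(2)[of 0] by simp
  \<comment> \<open>Extending the range to \<open>M + n\<close> adds only zeros and permits a split
    at \<open>M\<close> even when \<open>n\<close> is smaller than \<open>M\<close>.\<close>
  have "(\<Sum>j<n. \<Sum>m=1..n. c m * f (Suc j * m)) = (\<Sum>j<n. \<Sum>m=1..M+n. c m * f (Suc j * m))"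
  proof (rule sum.cong[OF refl], rule sum.mono_neutral_left)
    fix j
    show "\<forall>i\<in>{1..M + n} - {1..n}. c i * f (Suc j * i) = 0"
    proof
      fix i assume "i \<in> {1..M + n} - {1..n}"
      then have "n < Suc j * i" by (auto intro: less_le_trans)
      then show "c i * f (Suc j * i) = 0" by (simp add: f(2))
    qed
  qed auto
  also have "\<dots> = (\<Sum>j<n. (\<Sum>m=1..M. c m * f (Suc j * m))
      + (\<Sum>i<n. c (Suc M + i) * f (Suc j * (Suc M + i))))"
  proof (rule sum.cong[OF refl])
    fix j
    let ?g = "\<lambda>m. c m * f (Suc j * m)"
    have "sum ?g {1..M+n} = sum ?g {1..M} + sum ?g {Suc M..M+n}"
      using M sum.ub_add_nat[of 1 M ?g n] by simp
    also have "sum ?g {Suc M..M+n} = (\<Sum>i<n. ?g (Suc M + i))"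
      by (rule sum.reindex_bij_witness[of _ "\<lambda>i. Suc M + i" "\<lambda>m. m - Suc M"]) auto
    finally show "sum ?g {1..M+n} = sum ?g {1..M} + (\<Sum>i<n. ?g (Suc M + i))" .
  qed
  also have "\<dots> = (\<Sum>m=1..M. c m * T m)
      + (\<Sum>j<n. \<Sum>i<n. c (Suc M + i) * f (Suc j * (Suc M + i)))"
    unfolding sum.distrib T_def sum_distrib_left by (subst sum.swap) simp
  finally have split: "(\<Sum>j<n. \<Sum>m=1..n. c m * f (Suc j * m)) = \<dots>" .
  have "\<bar>\<Sum>j<n. \<Sum>i<n. c (Suc M + i) * f (Suc j * (Suc M + i))\<bar> \<le> (\<Sum>j<n. B * f (Suc j * M))"
  proof (rule sum_abs[THEN order_trans], rule sum_mono)
    fix j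
    have "\<bar>\<Sum>i<n. c (Suc M + i) * f (Suc j * (Suc M + i))\<bar> \<le> B * f (Suc j * (Suc M + 0))"
      by (rule Abel_summation_bound[where g = "\<lambda>i. f (Suc j * (Suc M + i))"])
        (use c(2) nonneg in \<open>auto intro!: antimonoI antimonoD[OF f(1)] add_mono mult_le_mono\<close>)
    also have "\<dots> \<le> B * f (Suc j * M)"
      using B by (intro mult_left_mono antimonoD[OF f(1)]) auto
    finally show "\<bar>\<Sum>i<n. c (Suc M + i) * f (Suc j * (Suc M + i))\<bar> \<le> B * f (Suc j * M)" .
  qed
  also have "\<dots> = B * T M" by (simp add: T_def sum_distrib_left)
  also have "\<dots> \<le> B * (P / real M)"
    using sum_multiples_bounds(1)[OF f M] M B
    by (intro mult_left_mono) (simp_all add: T_def P_def field_simps)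
  finally have tail: "- (B / real M * P) \<le> (\<Sum>j<n. \<Sum>i<n. c (Suc M + i) * f (Suc j * (Suc M + i)))"
    by (simp add: abs_le_iff)
  have "c m / real m * P - f 0 \<le> c m * T m" if "m \<in> {1..M}" for m
  proof -
    have m: "1 \<le> m" using that by simp
    have "\<bar>P / real m - T m\<bar> \<le> f 0"
      using sum_multiples_bounds[of f n m, OF f m] m nonneg[of 0]
      unfolding T_def[symmetric] P_def[symmetric]
      by (auto simp: abs_le_iff field_simps add_increasing2)
    then have "\<bar>c m\<bar> * \<bar>P / real m - T m\<bar> \<le> 1 * f 0"
      using c(1) by (intro mult_mono) auto
    then have "c m * (P / real m - T m) \<le> f 0"
      by (simp flip: abs_mult)
    then show ?thesis by (simp add: algebra_simps)
  qed
  then have "(\<Sum>m=1..M. c m / real m * P - f 0) \<le> (\<Sum>m=1..M. c m * T m)"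
    by (rule sum_mono)
  then have "(\<Sum>m=1..M. c m / real m) * P - real M * f 0 \<le> (\<Sum>m=1..M. c m * T m)"
    by (simp add: sum_subtractf sum_distrib_right)
  with tail split show ?thesis unfolding P_def[symmetric] by (simp add: algebra_simps)
qed

subsection \<open>The digamma criterion\<close>

lemma sum_residue_class:
  fixes w :: "nat \<Rightarrow> real"
  assumes "1 \<le> r" "r \<le> t"
  shows "(\<Sum>m=1..t * N. of_bool ([m = r] (mod t)) * w m) = (\<Sum>n<N. w (r + n * t))"
proof -
  have "(\<Sum>m=1..t * N. of_bool ([m = r] (mod t)) * w m)
      = (\<Sum>m\<in>{m \<in> {1..t * N}. [m = r] (mod t)}. w m)"
    by (intro sum.mono_neutral_cong_right) auto
  also have "\<dots> = (\<Sum>n<N. w (r + n * t))"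
  proof (rule sum.reindex_bij_witness[of _ "\<lambda>n. r + n * t" "\<lambda>m. (m - r) div t"])
    fix m assume m: "m \<in> {m \<in> {1..t * N}. [m = r] (mod t)}"
    \<comment> \<open>A smaller positive \<open>m\<close> is its own remainder modulo
      \<open>t\<close>. For \<open>r = t\<close> the remainder is 0, which \<open>m \<ge> 1\<close>
      excludes.\<close>
    have "r \<le> m"
    proof (rule ccontr)
      assume "\<not> r \<le> m"
      then have "m < t" "m mod t = r mod t" "m < r" using m assms by (auto simp: cong_def)
      then show False using m assms by (cases "r = t") auto
    qed
    then have "[m - r = 0] (mod t)" using m by (simp add: cong_diff_iff_cong_0_nat)
    then obtain q where q: "m = r + q * t"
      using \<open>r \<le> m\<close> by (metis cong_0_iff dvdE le_add_diff_inverse mult.commute)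
    have t: "0 < t" using assms by simp
    have "r + q * t \<le> t * N" using m q by auto
    then have "q * t < t * N" using assms(1) by linarith
    then have "q < N" by (simp add: mult.commute)
    then show *: "r + (m - r) div t * t = m" "(m - r) div t \<in> {..<N}" using q t by auto
    show "w (r + (m - r) div t * t) = w m" by (simp only: *)
  next
    fix n assume n: "n \<in> {..<N}"
    then have "(n + 1) * t \<le> N * t" by (intro mult_le_mono) auto
    then show "r + n * t \<in> {m \<in> {1..t * N}. [m = r] (mod t)}"
      using assms by (auto simp: algebra_simps cong_def)
    show "(r + n * t - r) div t = n" using assms by simp
  qed
  finally show ?thesis .
qed

text \<open>The multiples of \<open>k\<close> in the class of \<open>r\<close> are the
  \<open>k * m\<close> with \<open>m\<close> in the class of \<open>r'\<close>, so they are
  subtracted as a second progression. The range \<open>k * t * Q\<close> ends both progressions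
  exactly.\<close>

lemma sum_regular_residue_class:
  fixes w :: "nat \<Rightarrow> real"
  assumes "coprime k t" "2 \<le> k" "r \<in> {1..t}" "r' \<in> {1..t}" "[k * r' = r] (mod t)"
  shows "(\<Sum>m=1..k * t * Q. of_bool ([m = r] (mod t) \<and> \<not> k dvd m) * w m)
    = (\<Sum>n<k * Q. w (r + n * t)) - (\<Sum>n<Q. w (k * (r' + n * t)))"
proof -
  have k: "0 < k" using assms(2) by simp
  have cong: "[k * m = r] (mod t) \<longleftrightarrow> [m = r'] (mod t)" for m
    using assms(1,5) by (metis cong_mult_lcancel_nat cong_sym cong_trans)
  have "(\<Sum>m=1..k * t * Q. of_bool ([m = r] (mod t) \<and> k dvd m) * w m)
      = (\<Sum>m\<in>{m \<in> {1..k * t * Q}. [m = r] (mod t) \<and> k dvd m}. w m)"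
    by (intro sum.mono_neutral_cong_right) auto
  also have "\<dots> = (\<Sum>m\<in>{m \<in> {1..t * Q}. [m = r'] (mod t)}. w (k * m))"
  proof (rule sum.reindex_bij_witness[of _ "\<lambda>m. k * m" "\<lambda>m. m div k"])
    fix m assume "m \<in> {m \<in> {1..k * t * Q}. [m = r] (mod t) \<and> k dvd m}"
    moreover from this obtain q where "m = k * q" by auto
    ultimately show "k * (m div k) = m" "m div k \<in> {m \<in> {1..t * Q}. [m = r'] (mod t)}"
        "w (k * (m div k)) = w m"
      using k cong[of q] by (simp_all add: mult.assoc)
  next
    fix m assume "m \<in> {m \<in> {1..t * Q}. [m = r'] (mod t)}"
    then show "k * m div k = m" "k * m \<in> {m \<in> {1..k * t * Q}. [m = r] (mod t) \<and> k dvd m}"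
      using k cong[of m] by (simp_all add: mult.assoc)
  qed
  also have "\<dots> = (\<Sum>m=1..t * Q. of_bool ([m = r'] (mod t)) * w (k * m))"
    by (intro sum.mono_neutral_cong_left) auto
  also have "\<dots> = (\<Sum>n<Q. w (k * (r' + n * t)))"
    using assms by (intro sum_residue_class) auto
  finally have mult: "(\<Sum>m=1..k * t * Q. of_bool ([m = r] (mod t) \<and> k dvd m) * w m) = \<dots>" .
  have "(\<Sum>m=1..k * t * Q. of_bool ([m = r] (mod t) \<and> \<not> k dvd m) * w m)
      = (\<Sum>m=1..t * (k * Q). of_bool ([m = r] (mod t)) * w m)
        - (\<Sum>m=1..k * t * Q. of_bool ([m = r] (mod t) \<and> k dvd m) * w m)"
    unfolding mult.left_commute[of t k] mult.assoc sum_subtractf[symmetric]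
    by (intro sum.cong) auto
  then show ?thesis
    unfolding mult using assms by (subst (asm) sum_residue_class) auto
qed

definition residue_diff :: "nat \<Rightarrow> nat \<Rightarrow> nat \<Rightarrow> nat \<Rightarrow> nat \<Rightarrow> real" where
  "residue_diff k t r s m = of_bool ([m = r] (mod t) \<and> \<not> k dvd m)
    - of_bool ([m = s] (mod t) \<and> \<not> k dvd m)"

lemma sum_residue_diff:
  fixes w :: "nat \<Rightarrow> real"
  assumes "coprime k t" "2 \<le> k" "{r, s, r', s'} \<subseteq> {1..t}"
    and "[k * r' = r] (mod t)" "[k * s' = s] (mod t)"
  shows "(\<Sum>m=1..k * t * Q. residue_diff k t r s m * w m)
    = (\<Sum>n<k * Q. w (r + n * t) - w (s + n * t))
      - (\<Sum>n<Q. w (k * (r' + n * t)) - w (k * (s' + n * t)))"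
  unfolding residue_diff_def left_diff_distrib sum_subtractf
  using sum_regular_residue_class[of k t r r' w Q] sum_regular_residue_class[of k t s s' w Q] assms
  by simp

text \<open>With constant weight, the sums up to each multiple of \<open>k * t\<close> vanish. Only
  an incomplete last period remains, with terms of absolute value at most 1.\<close>

lemma residue_diff_partial_sum_bound:
  assumes "coprime k t" "2 \<le> k" "{r, s, r', s'} \<subseteq> {1..t}"
    and "[k * r' = r] (mod t)" "[k * s' = s] (mod t)"
  shows "\<bar>\<Sum>i<N. residue_diff k t r s (Suc (k * t * Q) + i)\<bar> \<le> real (k * t)"
proof -
  let ?c = "residue_diff k t r s" and ?T = "k * t"
  define X where "X N = sum ?c {1..N}" for N
  have zero: "X (?T * Q) = 0" for Q
    using sum_residue_diff[OF assms, of "\<lambda>_. 1" Q] by (simp add: X_def)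
  have split: "X (M + N) = X M + (\<Sum>i<N. ?c (Suc M + i))" for M N
    by (induction N) (simp_all add: X_def)
  have T: "0 < ?T" using assms by auto
  have c: "\<bar>?c m\<bar> \<le> 1" for m by (simp add: residue_diff_def)
  have "(\<Sum>i<N. ?c (Suc (?T * Q) + i)) = X (?T * Q + N)"
    using split[of "?T * Q" N] zero by simp
  also have "\<dots> = X (?T * ((?T * Q + N) div ?T) + (?T * Q + N) mod ?T)"
    by (simp only: mult_div_mod_eq)
  also have "\<dots> = (\<Sum>i<(?T * Q + N) mod ?T. ?c (Suc (?T * ((?T * Q + N) div ?T)) + i))"
    unfolding split zero by simp
  also have "\<bar>\<dots>\<bar> \<le> (\<Sum>i<(?T * Q + N) mod ?T. 1)"
    using c by (intro sum_abs[THEN order_trans] sum_mono) auto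
  also have "\<dots> \<le> real ?T"
    using T by (simp only: sum_constant card_lessThan mult_1_right of_nat_le_iff) (simp add: less_imp_le)
  finally show ?thesis .
qed

text \<open>In the difference of the two defining series the terms \<open>1 / (n + 1)\<close> and
  Euler's constant cancel.\<close>

lemma Digamma_diff_sums:
  fixes a b :: real
  assumes "0 < a" "0 < b"
  shows "(\<lambda>n. 1 / (a + real n) - 1 / (b + real n)) sums (Digamma b - Digamma a)"
proof -
  have "(\<lambda>n. (inverse (real (Suc n)) - inverse (b + real n)) - (inverse (real (Suc n)) - inverse (a + real n)))
      sums ((Digamma b + euler_mascheroni) - (Digamma a + euler_mascheroni))"
    using assms unfolding Digamma_def
    by (intro sums_diff) (simp_all add: summable_sums summable_Digamma del: of_nat_Suc)
  then show ?thesis by (simp add: inverse_eq_divide)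
qed

text \<open>The weight \<open>1 / m\<close> is inserted into \<open>sum_residue_diff\<close>.
  Dividing the progressions by \<open>t\<close>, and the second also by \<open>k\<close>, turns both
  sums into partial sums of digamma differences.\<close>

lemma residue_diff_harmonic_tendsto:
  fixes k t r s r' s' :: nat
  assumes "coprime k t" "2 \<le> k" "{r, s, r', s'} \<subseteq> {1..t}"
    and "[k * r' = r] (mod t)" "[k * s' = s] (mod t)"
  shows "(\<lambda>Q. \<Sum>m=1..k * t * Q. residue_diff k t r s m / real m) \<longlonglongrightarrow>
    (real k * (Digamma (real s / real t) - Digamma (real r / real t))
      - (Digamma (real s' / real t) - Digamma (real r' / real t))) / real (k * t)"
proof -
  define d where "d a b N = (\<Sum>n<N. 1 / (real a / real t + real n) - 1 / (real b / real t + real n))" for a b N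
  have t: "0 < t" and k: "0 < k" using assms by auto
  have lim: "d a b \<longlonglongrightarrow> Digamma (real b / real t) - Digamma (real a / real t)" if "0 < a" "0 < b" for a b
    using Digamma_diff_sums[of "real a / t" "real b / t"] that t
    unfolding d_def sums_def by simp
  have frac: "1 / (real a / real t + real n) = real t * (1 / real (a + n * t))" for a n
    using t by (simp add: field_simps)
  have "(\<Sum>m=1..k * t * Q. residue_diff k t r s m / real m)
      = (real k * d r s (k * Q) - d r' s' Q) / real (k * t)" for Q
  proof -
    have "(\<Sum>m=1..k * t * Q. residue_diff k t r s m * (1 / real m))
        = (\<Sum>n<k * Q. 1 / real (r + n * t) - 1 / real (s + n * t))
          - (\<Sum>n<Q. 1 / real (k * (r' + n * t)) - 1 / real (k * (s' + n * t)))"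
      by (rule sum_residue_diff[OF assms])
    also have "(\<Sum>n<Q. 1 / real (k * (r' + n * t)) - 1 / real (k * (s' + n * t)))
        = (\<Sum>n<Q. 1 / real (r' + n * t) - 1 / real (s' + n * t)) / k"
      unfolding sum_divide_distrib by (intro sum.cong) (simp_all add: diff_divide_distrib mult.commute)
    finally have "(\<Sum>m=1..k * t * Q. residue_diff k t r s m / real m)
        = (\<Sum>n<k * Q. 1 / real (r + n * t) - 1 / real (s + n * t))
          - (\<Sum>n<Q. 1 / real (r' + n * t) - 1 / real (s' + n * t)) / k"
      by simp
    moreover have "A - B / real k = (real k * (real t * A) - real t * B) / real (k * t)" for A B
      using t k by (simp add: field_simps)
    ultimately show ?thesis
      unfolding d_def frac right_diff_distrib[symmetric] sum_distrib_left[symmetric]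
      by (simp only:)
  qed
  moreover have "(\<lambda>Q. d r s (k * Q)) \<longlonglongrightarrow> Digamma (real s / real t) - Digamma (real r / real t)"
  proof (rule filterlim_compose[OF lim])
    show "filterlim (\<lambda>Q. k * Q) at_top sequentially"
      using k by (simp add: mult_nat_left_at_top)
  qed (use assms in auto)
  ultimately show ?thesis
    using assms k t by (auto intro!: tendsto_intros lim)
qed

text \<open>The hypothesis \<open>less\<close> says that the limit \<open>S\<close> of the harmonic
  sums is positive. The lower bound for weighted multiples is then positive for all large
  \<open>n\<close>, since \<open>f 0\<close> is negligible against the total mass.\<close>

theorem succ_kt_if_Digamma_less:
  fixes k t r s r' s' :: nat
  assumes "coprime k t" "2 \<le> k" "{r, s, r', s'} \<subseteq> {1..t}"
    and "[k * r' = r] (mod t)" "[k * s' = s] (mod t)"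
    and less: "Digamma (real s' / real t) - Digamma (real r' / real t)
    < real k * (Digamma (real s / real t) - Digamma (real r / real t))"
  shows "succ_kt k t r s"
proof -
  let ?c = "residue_diff k t r s"
  note hyps = assms(1-5)
  define S where "S = (real k * (Digamma (real s / real t) - Digamma (real r / real t))
    - (Digamma (real s' / real t) - Digamma (real r' / real t))) / real (k * t)"
  have t: "0 < t" and k: "0 < k" using assms by auto
  have "0 < S" using less t k by (simp add: S_def)
  \<comment> \<open>The subtracted \<open>inverse (real Q)\<close> is the tail loss
    \<open>B / M\<close> for \<open>B = k * t\<close> and \<open>M = k * t * Q\<close>.\<close>
  have "(\<lambda>Q. (\<Sum>m=1..k * t * Q. ?c m / real m) - inverse (real Q)) \<longlonglongrightarrow> S - 0"
    unfolding S_def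
    by (intro tendsto_diff residue_diff_harmonic_tendsto[OF hyps] lim_inverse_n)
  then have "\<forall>\<^sub>F Q in sequentially. S / 2 < (\<Sum>m=1..k * t * Q. ?c m / real m) - inverse (real Q)"
    using \<open>0 < S\<close> by (intro order_tendstoD) auto
  then have "\<forall>\<^sub>F Q in sequentially. S / 2 < (\<Sum>m=1..k * t * Q. ?c m / real m) - inverse (real Q) \<and> 0 < Q"
    by (intro eventually_conj eventually_gt_at_top)
  then obtain Q where Q: "S / 2 < (\<Sum>m=1..k * t * Q. ?c m / real m) - inverse (real Q)" "0 < Q"
    by (auto simp: eventually_sequentially)
  define M where "M = k * t * Q"
  have M: "1 \<le> M" using Q t k by (simp add: M_def Suc_le_eq)
  \<comment> \<open>This \<open>L\<close> makes the boundary error \<open>M * f 0\<close> smaller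
    than \<open>S / 2\<close> times the total mass, once that mass is at least
    \<open>L * f 0\<close>.\<close>
  obtain L where L: "real M < real L * (S / 2)"
    using reals_Archimedean3[of "S / 2"] \<open>0 < S\<close> by auto
  show ?thesis
    unfolding succ_kt_def
    using num_regular_small[OF assms(2), of L]
  proof eventually_elim
    case (elim n)
    define f where "f i = real (num_regular_diff k n i)" for i
    have f: "antimono f" "n < i \<Longrightarrow> f i = 0" for i
      using num_regular_mono[OF assms(2)]
      by (auto simp: f_def num_regular_diff_def intro!: antimonoI)
    have f0: "f 0 = real (num_regular k n)" by (simp add: f_def num_regular_diff_def)
    have "(\<Sum>i<n. f (Suc i)) = (\<Sum>i<n. real (num_regular k (n - Suc i)))"
      by (intro sum.cong) (auto simp: f_def num_regular_diff_def)
    also have "\<dots> = (\<Sum>i<n. real (num_regular k i))" by (rule sum.nat_diff_reindex)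
    finally have P: "(\<Sum>i<n. f (Suc i)) = \<dots>" .
    have D: "real (Dx k a t n) = (\<Sum>j<n. \<Sum>m=1..n. of_bool ([m = a] (mod t) \<and> \<not> k dvd m)
        * f (Suc j * m))" for a
      unfolding Dx_eq f_def by (simp del: mult_Suc)
    have "M = {#}" if "M \<in> regular k 0" for M
      using that size_le_sum_mset_nat[of M] unfolding regular_iff
      by (metis le_zero_eq size_eq_0_iff_empty)
    then have "regular k 0 = {{#}}" by (auto simp: regular_iff)
    then have "1 \<le> num_regular k n"
      using num_regular_mono[OF assms(2), of 0 n] by (simp add: num_regular_def)
    then have "real M * f 0 < real L * (S / 2) * f 0" using L f0 by simp
    also have "\<dots> = S / 2 * real (L * num_regular k n)" by (simp add: f0)
    also have "\<dots> \<le> S / 2 * (\<Sum>i<n. f (Suc i))"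
      using elim \<open>0 < S\<close> unfolding P of_nat_sum[symmetric]
      by (intro mult_left_mono) (simp_all only: of_nat_le_iff)
    also have "\<dots> \<le> ((\<Sum>m=1..M. ?c m / real m) - real (k * t) / real M) * (\<Sum>i<n. f (Suc i))"
      using Q t k by (intro mult_right_mono) (auto simp: M_def inverse_eq_divide f_def sum_nonneg)
    finally have "0 < ((\<Sum>m=1..M. ?c m / real m) - real (k * t) / real M) * (\<Sum>i<n. f (Suc i)) - real M * f 0"
      by simp
    also have "\<dots> \<le> (\<Sum>j<n. \<Sum>m=1..n. ?c m * f (Suc j * m))"
      using M f residue_diff_partial_sum_bound[OF hyps]
      by (intro weighted_multiples_lower_bound) (auto simp: residue_diff_def M_def)
    also have "\<dots> = real (Dx k r t n) - real (Dx k s t n)"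
      unfolding D residue_diff_def left_diff_distrib sum_subtractf ..
    finally show ?case by simp
  qed
qed

subsection \<open>Digamma inequalities and orderings\<close>

lemma sums_strict_mono:
  fixes f g :: "nat \<Rightarrow> real"
  assumes "f sums a" "g sums b" "\<And>n. f n \<le> g n" "f i < g i"
  shows "a < b"
proof -
  have s: "(\<lambda>n. g n - f n) sums (b - a)" using assms by (intro sums_diff)
  have "0 < (\<Sum>n. g n - f n)"
    using assms by (intro suminf_pos2[OF sums_summable[OF s], of i]) auto
  then show ?thesis using sums_unique[OF s] by simp
qed

lemma reciprocal_diff:
  fixes c e :: real
  assumes "0 < c" "0 \<le> e"
  shows "1 / (c + real n) - 1 / (c + e + real n) = e / ((c + real n) * (c + e + real n))"
  using assms by (subst diff_frac_eq) (auto simp: add_nonneg_eq_0_iff)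

lemma inverse_squares_sums': "(\<lambda>n. 1 / (real n + 1)\<^sup>2) sums (pi\<^sup>2 / 6)"
  using inverse_squares_sums by (simp add: add.commute)

text \<open>This is concavity of \<open>Digamma\<close> on the positive axis, visible in each term
  of the series.\<close>

lemma Digamma_increment_mono:
  fixes a b d :: real
  assumes "0 < a" "a \<le> b" "0 \<le> d"
  shows "Digamma (b + d) - Digamma b \<le> Digamma (a + d) - Digamma a"
proof (rule sums_le[OF _ Digamma_diff_sums Digamma_diff_sums])
  fix n :: nat
  have "d / ((b + n) * (b + d + n)) \<le> d / ((a + n) * (a + d + n))"
    using assms by (intro divide_left_mono mult_mono mult_pos_pos) auto
  then show "1 / (b + n) - 1 / (b + d + n) \<le> 1 / (a + n) - 1 / (a + d + n)"
    using assms by (simp add: reciprocal_diff)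
qed (use assms in auto)

text \<open>The recurrence splits off the pole \<open>- 1 / x\<close> at zero, and the remainder
  \<open>Digamma (x + 1)\<close> is increasing.\<close>

lemma Digamma_increment_ge:
  fixes a b :: real
  assumes "0 < a" "a \<le> b"
  shows "1 / a - 1 / b \<le> Digamma b - Digamma a"
proof -
  have "Digamma (a + 1) \<le> Digamma (b + 1)" using assms by (intro Digamma_real_mono) auto
  then show ?thesis using assms by (simp add: Digamma_plus1)
qed

lemma Digamma_1_minus_less:
  fixes x :: real
  assumes "0 < x"
  shows "Digamma 1 - Digamma x < 1 / x"
proof -
  have "Digamma 1 < Digamma (x + 1)" using assms by (intro Digamma_real_strict_mono) auto
  then show ?thesis using assms by (simp add: Digamma_plus1)
qed

text \<open>The extreme case is \<open>b = t\<close> and \<open>a = 1\<close>, where the pole at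
  zero contributes \<open>t\<close>.\<close>

lemma Digamma_residue_diff_less:
  assumes "a \<in> {1..t}" "b \<in> {1..t}"
  shows "Digamma (real b / real t) - Digamma (real a / real t) < real t"
proof -
  have "Digamma (real b / real t) \<le> Digamma 1"
    using assms by (intro Digamma_real_mono) auto
  moreover have "Digamma (1 / real t) \<le> Digamma (real a / real t)"
    using assms by (intro Digamma_real_mono) (auto simp: divide_right_mono)
  ultimately show ?thesis using Digamma_1_minus_less[of "1 / real t"] assms by auto
qed

text \<open>Summand by summand, with \<open>k * a + k * n\<close> on one side facing \<open>u + n\<close> on the other.\<close>
lemma Digamma_scaled_increment_less:
  fixes a d k u :: real
  assumes "0 < u" "0 < a" "0 < d" "1 < k" "u \<le> k * a"
  shows "Digamma (a + d) - Digamma a < k * (Digamma (u + k * d) - Digamma u)"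
proof (rule sums_strict_mono[OF Digamma_diff_sums sums_mult[OF Digamma_diff_sums]])
  have lhs: "d / ((a + n) * (a + d + n)) = k * (k * d) / ((k * a + k * n) * (k * a + k * d + k * n))"
    for n :: nat
  proof -
    have "(k * a + k * n) * (k * a + k * d + k * n) = k * k * ((a + n) * (a + d + n))"
      by (simp add: algebra_simps)
    then show ?thesis using assms by simp
  qed
  have kn: "real n \<le> k * n" for n using assms by (simp add: mult_le_cancel_right1)
  have pos: "0 < (u + n) * (u + k * d + n)" for n :: nat
    using assms by (intro mult_pos_pos) (auto intro!: add_pos_nonneg)
  show "1 / (a + n) - 1 / (a + d + n) \<le> k * (1 / (u + n) - 1 / (u + k * d + n))" for n :: nat
  proof -
    have "k * (k * d) / ((k * a + k * n) * (k * a + k * d + k * n))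
        \<le> k * (k * d) / ((u + n) * (u + k * d + n))"
      using assms kn[of n] pos[of n] by (intro divide_left_mono mult_mono mult_pos_pos add_mono)
        (auto intro!: add_pos_nonneg)
    then show ?thesis using assms reciprocal_diff[of a d n] reciprocal_diff[of u "k * d" n] lhs[of n] by simp
  qed
  \<comment> \<open>Strictness is taken from \<open>n = 1\<close>, because the terms at
    \<open>n = 0\<close> agree when \<open>u = k * a\<close>.\<close>
  show "1 / (a + real 1) - 1 / (a + d + real 1) < k * (1 / (u + real 1) - 1 / (u + k * d + real 1))"
  proof -
    have "(u + 1) * (u + k * d + 1) < (k * a + k * 1) * (k * a + k * d + k * 1)"
      using assms by (intro mult_strict_mono') (auto intro!: add_pos_pos)
    then have "k * (k * d) / ((k * a + k * 1) * (k * a + k * d + k * 1))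
        < k * (k * d) / ((u + 1) * (u + k * d + 1))"
      using assms pos[of 1] by (intro divide_strict_left_mono mult_pos_pos add_pos_pos) auto
    then show ?thesis using assms reciprocal_diff[of a d 1] reciprocal_diff[of u "k * d" 1] lhs[of 1] by simp
  qed
qed (use assms in \<open>auto intro!: add_pos_pos\<close>)

text \<open>Dropping \<open>x\<close> from the denominators leaves the series of inverse
  squares.\<close>

lemma Digamma_1_increment_le:
  fixes x :: real
  assumes "0 \<le> x"
  shows "Digamma (1 + x) - Digamma 1 \<le> pi\<^sup>2 / 6 * x"
proof (rule sums_le[OF _ Digamma_diff_sums sums_mult2[OF inverse_squares_sums']])
  fix n :: nat
  have "1 / (1 + real n) - 1 / (1 + x + real n) = x / ((real n + 1) * (real n + 1 + x))"
    using assms by (subst reciprocal_diff) (simp_all add: ac_simps)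
  also have "\<dots> \<le> x / (real n + 1)\<^sup>2"
    using assms by (auto simp: power2_eq_square intro!: divide_left_mono mult_left_mono mult_pos_pos)
  finally show "1 / (1 + real n) - 1 / (1 + x + real n) \<le> 1 / (real n + 1)\<^sup>2 * x" by simp
qed (use assms in auto)

text \<open>The first-order part sums to \<open>pi\<^sup>2 / 6 * x\<close>. Of the exact remainder,
  the lower estimate below keeps only \<open>n = 0\<close>, while the upper one also bounds the
  later terms.\<close>

lemma Digamma_1_decrement_term:
  fixes x :: real
  assumes "x < 1"
  shows "1 / (1 - x + real n) - 1 / (1 + real n)
    = x * (1 / (real n + 1)\<^sup>2) + x\<^sup>2 / ((real n + 1)\<^sup>2 * (real n + 1 - x))"
proof -
  have "1 / (y - x) - 1 / y = x * (1 / y\<^sup>2) + x\<^sup>2 / (y\<^sup>2 * (y - x))" if "y \<noteq> 0" "y - x \<noteq> 0" for y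
    using that by (simp add: divide_simps) (simp add: algebra_simps power2_eq_square)
  from this[of "real n + 1"] show ?thesis using assms by (simp add: algebra_simps)
qed

lemma Digamma_1_decrement_ge:
  fixes x :: real
  assumes "0 < x" "x < 1"
  shows "pi\<^sup>2 / 6 * x + x\<^sup>2 / (1 - x) \<le> Digamma 1 - Digamma (1 - x)"
proof (rule sums_le[OF _ _ Digamma_diff_sums])
  show "(\<lambda>n. 1 / (real n + 1)\<^sup>2 * x + (if n = 0 then x\<^sup>2 / (1 - x) else 0))
      sums (pi\<^sup>2 / 6 * x + x\<^sup>2 / (1 - x))"
    by (intro sums_add sums_mult2 inverse_squares_sums' sums_single)
  show "1 / (real n + 1)\<^sup>2 * x + (if n = 0 then x\<^sup>2 / (1 - x) else 0)
      \<le> 1 / (1 - x + real n) - 1 / (1 + real n)" for n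
    unfolding Digamma_1_decrement_term[OF assms(2)] using assms by (auto simp: divide_simps)
qed (use assms in auto)

lemma Digamma_1_decrement_le:
  fixes x :: real
  assumes "0 < x" "x < 1"
  shows "Digamma 1 - Digamma (1 - x) \<le> pi\<^sup>2 / 6 * x + x\<^sup>2 / (1 - x) + (pi\<^sup>2 / 6 - 1) * (x\<^sup>2 / (2 - x))"
proof (rule sums_le[OF _ Digamma_diff_sums])
  \<comment> \<open>For \<open>n \<ge> 1\<close> the remainder is at most
    \<open>C / (n + 1)\<^sup>2\<close>. The full inverse-square series also counts
    \<open>n = 0\<close>, so \<open>C\<close> is taken off there, giving the factor
    \<open>pi\<^sup>2 / 6 - 1\<close>.\<close>
  define C where "C = x\<^sup>2 / (2 - x)"
  have "(\<lambda>n. 1 / (real n + 1)\<^sup>2 * x + 1 / (real n + 1)\<^sup>2 * C + (if n = 0 then x\<^sup>2 / (1 - x) - C else 0))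
      sums (pi\<^sup>2 / 6 * x + pi\<^sup>2 / 6 * C + (x\<^sup>2 / (1 - x) - C))"
    by (intro sums_add sums_mult2 inverse_squares_sums' sums_single)
  then show "(\<lambda>n. 1 / (real n + 1)\<^sup>2 * x + 1 / (real n + 1)\<^sup>2 * C + (if n = 0 then x\<^sup>2 / (1 - x) - C else 0))
      sums (pi\<^sup>2 / 6 * x + x\<^sup>2 / (1 - x) + (pi\<^sup>2 / 6 - 1) * (x\<^sup>2 / (2 - x)))"
    by (simp add: C_def algebra_simps)
  show "1 / (1 - x + real n) - 1 / (1 + real n)
      \<le> 1 / (real n + 1)\<^sup>2 * x + 1 / (real n + 1)\<^sup>2 * C + (if n = 0 then x\<^sup>2 / (1 - x) - C else 0)" for n
  proof (cases "n = 0")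
    case False
    then have "x\<^sup>2 / ((real n + 1)\<^sup>2 * (real n + 1 - x)) \<le> x\<^sup>2 / ((real n + 1)\<^sup>2 * (2 - x))"
      using assms by (intro divide_left_mono mult_left_mono mult_pos_pos) auto
    then show ?thesis
      unfolding Digamma_1_decrement_term[OF assms(2)] using False by (simp add: C_def mult.commute)
  qed (use assms in \<open>simp add: field_simps power2_eq_square\<close>)
qed (use assms in auto)

lemma pi_squared_sixth_bounds: "3 / 2 \<le> pi\<^sup>2 / 6" "pi\<^sup>2 / 6 \<le> 1645 / 1000"
proof -
  have "3\<^sup>2 \<le> pi\<^sup>2" using pi_gt3 by (intro power_mono) auto
  then show "3 / 2 \<le> pi\<^sup>2 / 6" by simp
  have "pi \<le> 31416 / 10000" using pi_approx(2) by simp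
  then have "pi\<^sup>2 \<le> (31416 / 10000)\<^sup>2" by (intro power_mono) auto
  then show "pi\<^sup>2 / 6 \<le> 1645 / 1000" by (simp add: power2_eq_square)
qed

section \<open>Comparisons between residue classes\<close>

lemma obtain_residue_quotient:
  fixes k t r :: nat
  assumes "coprime k t" "1 \<le> t"
  obtains r' where "r' \<in> {1..t}" "[k * r' = r] (mod t)"
proof -
  obtain x where x: "[k * x = Suc 0] (mod t)" using assms cong_solve_coprime_nat by blast
  define r' where "r' = (if x * r mod t = 0 then t else x * r mod t)"
  have "[r' = x * r] (mod t)" by (auto simp: r'_def cong_def)
  then have "[k * r' = k * (x * r)] (mod t)" by (rule cong_scalar_left)
  also have "k * (x * r) = k * x * r" by (simp add: mult.assoc)
  also have "[k * x * r = Suc 0 * r] (mod t)" using x by (rule cong_scalar_right)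
  finally have "[k * r' = r] (mod t)" by simp
  moreover have "r' \<in> {1..t}"
    using assms mod_less_divisor[of t "x * r"] by (auto simp: r'_def Suc_le_eq intro: less_imp_le)
  ultimately show ?thesis using that by blast
qed

text \<open>Adding \<open>k\<close> to \<open>r\<close> adds 1 to the quotient \<open>r'\<close>, so
  the two increments are those of \<open>Digamma_scaled_increment_less\<close> with
  \<open>u = r / t\<close>, \<open>a = r' / t\<close> and \<open>d = 1 / t\<close>.\<close>

lemma succ_kt_add:
  assumes "coprime k t" "2 \<le> k" "1 \<le> r" "r + k \<le> t"
  shows "succ_kt k t r (r + k)"
proof -
  obtain r' where r': "r' \<in> {1..t}" "[k * r' = r] (mod t)"
    using assms obtain_residue_quotient[of k t r] by auto
  have r: "k * r' mod t = r" using r'(2) assms by (simp add: cong_def)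
  \<comment> \<open>This keeps \<open>Suc r'\<close> within \<open>{1..t}\<close>.\<close>
  then have "r' \<noteq> t" using assms by auto
  have "r \<le> k * r'" using r by (metis mod_less_eq_dividend)
  have "[k * Suc r' = r + k] (mod t)"
    using cong_add[OF r'(2) cong_refl[of k]] by (simp add: add.commute)
  moreover have "Digamma (real (Suc r') / t) - Digamma (real r' / t)
      < real k * (Digamma (real (r + k) / t) - Digamma (real r / t))"
    using Digamma_scaled_increment_less[of "real r / t" "real r' / t" "1 / t" "real k"]
      assms r' \<open>r \<le> k * r'\<close>
    by (auto simp: divide_right_mono add_divide_distrib[symmetric] add.commute simp flip: of_nat_mult)
  ultimately show ?thesis
    using assms r' \<open>r' \<noteq> t\<close> by (intro succ_kt_if_Digamma_less[of k t r _ r' "Suc r'"]) auto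
qed

text \<open>Whatever the quotients \<open>r'\<close> and \<open>s'\<close> are, their digamma
  difference stays below \<open>t\<close>.\<close>

lemma succ_kt_if_increment_ge:
  assumes "coprime k t" "2 \<le> k" "1 \<le> r" "r < s" "s \<le> t"
    and "real t \<le> real k * (Digamma (real s / t) - Digamma (real r / t))"
  shows "succ_kt k t r s"
proof -
  obtain r' where r': "r' \<in> {1..t}" "[k * r' = r] (mod t)"
    using assms obtain_residue_quotient[of k t r] by auto
  obtain s' where s': "s' \<in> {1..t}" "[k * s' = s] (mod t)"
    using assms obtain_residue_quotient[of k t s] by auto
  show ?thesis
    using assms r' s' Digamma_residue_diff_less[of r' t s']
    by (intro succ_kt_if_Digamma_less[of k t r s r' s']) auto
qed

text \<open>The pole terms suffice: between \<open>r / t\<close> and \<open>(r + 1) / t\<close> the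
  function \<open>1 / x\<close> drops by \<open>t / (r * (r + 1))\<close>.\<close>

lemma succ_kt_if_ge_mult_Suc:
  assumes "coprime k t" "2 \<le> k" "1 \<le> r" "r < s" "s \<le> t" and k: "r * (r + 1) \<le> k"
  shows "succ_kt k t r s"
proof (rule succ_kt_if_increment_ge)
  have "T = R * (R + 1) * (T / R - T / (R + 1))" if "0 < R" for R T :: real
  proof -
    have "T / R - T / (R + 1) = T / (R * (R + 1))"
      using that by (subst diff_frac_eq) (auto simp: algebra_simps)
    then show ?thesis using that by simp
  qed
  from this[of "real r" "real t"]
  have "real t = real (r * (r + 1)) * (1 / (real r / t) - 1 / (real (r + 1) / t))"
    using assms
    unfolding of_nat_mult of_nat_add of_nat_1 divide_divide_eq_right mult_1_left by simp
  also have "\<dots> \<le> real k * (1 / (real r / t) - 1 / (real (r + 1) / t))"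
    using k assms by (intro mult_right_mono) (auto simp: field_simps simp flip: of_nat_mult of_nat_add)
  also have "\<dots> \<le> real k * (1 / (real r / t) - 1 / (real s / t))"
    using assms by (intro mult_left_mono diff_left_mono divide_left_mono divide_right_mono mult_pos_pos) auto
  also have "\<dots> \<le> real k * (Digamma (real s / t) - Digamma (real r / t))"
    using assms by (intro mult_left_mono Digamma_increment_ge) (auto simp: divide_right_mono)
  finally show "real t \<le> \<dots>" .
qed (use assms in auto)

text \<open>By concavity the smallest increment is the last one, from \<open>1 - 1 / t\<close> to 1,
  so only that one has to be estimated.\<close>

lemma succ_kt_if_large:
  assumes "coprime k t" "2 \<le> k" "1 \<le> r" "r < s" "s \<le> t"
    and k: "6 * (real t ^ 2 - 1) / pi ^ 2 \<le> real k"
  shows "succ_kt k t r s"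
proof (rule succ_kt_if_increment_ge)
  define z where "z = pi\<^sup>2 / 6"
  define x where "x = 1 / real t"
  have z: "3 / 2 \<le> z" "z \<le> 1645 / 1000" unfolding z_def by (rule pi_squared_sixth_bounds)+
  have t: "2 \<le> real t" using assms by simp
  have kz: "(real t ^ 2 - 1) / z \<le> real k" using k unfolding z_def by (simp add: mult.commute)
  \<comment> \<open>The first-order term alone gives \<open>t - 1 / t\<close>; the second-order term
    supplies \<open>(t + 1) / (z * t)\<close>, which covers the deficit.\<close>
  have "real t \<le> (real t ^ 2 - 1) / z * (z * x + x\<^sup>2 / (1 - x))"
  proof -
    have "(real t ^ 2 - 1) / z * (z * x + x\<^sup>2 / (1 - x)) = ((real t ^ 2 - 1) + (real t + 1) / z) / t"
      using t z by (simp add: x_def divide_simps) (simp add: algebra_simps power2_eq_square)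
    moreover have "1 \<le> (real t + 1) / z" using t z by simp
    ultimately show ?thesis using t by (simp add: le_divide_eq power2_eq_square)
  qed
  also have "\<dots> \<le> real k * (z * x + x\<^sup>2 / (1 - x))"
    using kz t z by (intro mult_right_mono) (auto simp: x_def)
  also have "\<dots> \<le> real k * (Digamma 1 - Digamma (1 - x))"
    using t unfolding z_def by (intro mult_left_mono Digamma_1_decrement_ge) (auto simp: x_def)
  also have "\<dots> \<le> real k * (Digamma (real r / t + x) - Digamma (real r / t))"
  proof -
    have "real r / t \<le> 1 - x" using assms t by (simp add: x_def field_simps)
    then show ?thesis
      using Digamma_increment_mono[of "real r / t" "1 - x" x] assms t
      by (intro mult_left_mono) (auto simp: x_def)
  qed
  also have "\<dots> \<le> real k * (Digamma (real s / t) - Digamma (real r / t))"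
  proof -
    have "real r / t + x = real (r + 1) / t" by (simp add: x_def add_divide_distrib)
    also have "\<dots> \<le> real s / t" using assms by (intro divide_right_mono) auto
    finally have "real r / t + x \<le> real s / t" .
    then show ?thesis
      using assms t by (intro mult_left_mono diff_right_mono Digamma_real_mono)
        (auto simp: x_def intro!: add_pos_pos)
  qed
  finally show "real t \<le> \<dots>" .
qed (use assms in auto)

text \<open>Here \<open>k\<close> is congruent to -1, so the quotients of \<open>t\<close> and
  \<open>t - 1\<close> are \<open>t\<close> and 1. The pole near zero, at argument
  \<open>1 / t\<close>, must outweigh \<open>k\<close> times the last increment.\<close>

lemma succ_kt_last:
  assumes "coprime k t" "2 \<le> k" "2 \<le> t" "1 \<le> m" "k = m * t - 1"
    and k: "real k \<le> inverse (pi ^ 2 / 6 + 5 / (2 * real t)) * (real t ^ 2 - 1)"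
  shows "succ_kt k t t (t - 1)"
proof -
  define z where "z = pi\<^sup>2 / 6"
  define x where "x = 1 / real t"
  have z: "3 / 2 \<le> z" "z \<le> 1645 / 1000" unfolding z_def by (rule pi_squared_sixth_bounds)+
  \<comment> \<open>For \<open>t = 2\<close> the upper bound on \<open>k\<close> falls below 2. Its
    exclusion gives \<open>x \<le> 1 / 3\<close>.\<close>
  have "t \<noteq> 2"
  proof
    assume "t = 2"
    then have "2 \<le> inverse (z + 5 / 4) * 3" using k assms(2) by (simp add: z_def)
    then show False using z by (simp add: field_simps)
  qed
  then have t: "3 \<le> real t" using assms by simp
  have x: "0 < x" "x \<le> 1 / 3" using t by (auto simp: x_def field_simps)
  have kx: "real k \<le> (1 / x\<^sup>2 - 1) / (z + 5 / 2 * x)"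
    using k by (simp add: z_def x_def power2_eq_square field_simps)
  define U where "U = z * x + x\<^sup>2 / (1 - x) + (z - 1) * (x\<^sup>2 / (2 - x))"
  have "0 \<le> U" using x z by (auto simp: U_def intro!: add_nonneg_nonneg)
  \<comment> \<open>This is the target inequality \<open>k * U < 1 / x - z * x\<close> at the
    largest permitted \<open>k\<close>, with denominators cleared.\<close>
  have "(1 - x\<^sup>2) * U < x * ((1 - z * x\<^sup>2) * (z + 5 / 2 * x))"
  proof -
    \<comment> \<open>The quotient has maximum \<open>4 - 2 * sqrt 3\<close> for \<open>x\<close> in
      this range, just below \<open>27 / 50\<close>.\<close>
    have "(1 - x\<^sup>2) / (2 - x) \<le> 27 / 50"
    proof -
      have "0 \<le> (10 * x - 27 / 10)\<^sup>2" by simp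
      then show ?thesis using x by (simp add: field_simps power2_eq_square)
    qed
    then have frac: "(z - 1) * x * ((1 - x\<^sup>2) / (2 - x)) \<le> (z - 1) * x * (27 / 50)"
      using x z by (intro mult_left_mono) auto
    have U: "(1 - x\<^sup>2) * U = x * (z * (1 - x\<^sup>2) + x * (1 + x) + (z - 1) * x * ((1 - x\<^sup>2) / (2 - x)))"
    proof -
      have "(1 - x\<^sup>2) * (x\<^sup>2 / (1 - x)) = x * (x * (1 + x))"
        using x by (simp add: field_simps power2_eq_square)
      then show ?thesis by (simp add: U_def algebra_simps power2_eq_square)
    qed
    \<comment> \<open>The leading \<open>z\<close> cancels, and the difference of the sides is
      \<open>x\<close> times the bracket shown positive below. At \<open>x = 1 / 3\<close> and
      \<open>z = 1645 / 1000\<close> that bracket is less than \<open>1 / 100\<close>, which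
      explains the sharp bound on \<open>z\<close>.\<close>
    have "z * (1 - x\<^sup>2) + x * (1 + x) + (z - 1) * x * (27 / 50) < (1 - z * x\<^sup>2) * (z + 5 / 2 * x)"
    proof -
      have "z\<^sup>2 \<le> (1645 / 1000)\<^sup>2" using z by (intro power_mono) auto
      moreover have "z * (z - 1) \<le> 1645 / 1000 * (1645 / 1000 - 1)" using z by (intro mult_mono) auto
      ultimately have "z\<^sup>2 - z + 1 \<le> 2062 / 1000" by (simp add: power2_eq_square algebra_simps)
      moreover have "0 \<le> z * (z - 1)" using z by (intro mult_nonneg_nonneg) auto
      then have "0 \<le> z\<^sup>2 - z + 1" unfolding power2_eq_square right_diff_distrib by linarith
      ultimately have "x * (z\<^sup>2 - z + 1) \<le> 1 / 3 * (2062 / 1000)"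
        using x by (intro mult_mono) auto
      moreover have "x\<^sup>2 * z \<le> (1 / 3)\<^sup>2 * (1645 / 1000)"
        using x z by (intro mult_mono power_mono) auto
      ultimately have "0 < 102 / 50 - 27 / 50 * z - x * (z\<^sup>2 - z + 1) - 5 / 2 * (x\<^sup>2 * z)"
        using z by (simp add: power2_eq_square)
      then have "0 < x * (102 / 50 - 27 / 50 * z - x * (z\<^sup>2 - z + 1) - 5 / 2 * (x\<^sup>2 * z))"
        using x by simp
      then show ?thesis
        by (simp add: algebra_simps power2_eq_square add_divide_distrib diff_divide_distrib)
    qed
    with frac show ?thesis unfolding U by (intro mult_strict_left_mono x) linarith
  qed
  have "real k * (Digamma 1 - Digamma (1 - x)) \<le> real k * U"
    using Digamma_1_decrement_le[of x] x by (intro mult_left_mono) (auto simp: U_def z_def)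
  also have "\<dots> \<le> (1 / x\<^sup>2 - 1) / (z + 5 / 2 * x) * U"
    using kx \<open>0 \<le> U\<close> by (rule mult_right_mono)
  also have "\<dots> = (1 - x\<^sup>2) * U / (x\<^sup>2 * (z + 5 / 2 * x))"
    using x by (simp add: field_simps)
  also have "\<dots> < 1 / x - z * x"
  proof -
    have "(1 / x - z * x) * (x\<^sup>2 * (z + 5 / 2 * x)) = x * ((1 - z * x\<^sup>2) * (z + 5 / 2 * x))"
      using x by (simp add: field_simps power2_eq_square)
    moreover have "0 < x\<^sup>2 * (z + 5 / 2 * x)" using x z by (intro mult_pos_pos add_pos_pos) auto
    ultimately show ?thesis using \<open>(1 - x\<^sup>2) * U < _\<close> by (simp only: pos_divide_less_eq)
  qed
  also have "\<dots> \<le> Digamma 1 - Digamma x"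
    using Digamma_1_increment_le[of x] Digamma_plus1[of x] x by (simp add: z_def add.commute)
  finally have "real k * (Digamma 1 - Digamma (1 - x)) < Digamma 1 - Digamma x" .
  then have "Digamma x - Digamma 1 < real k * (Digamma (1 - x) - Digamma 1)"
    by (simp add: algebra_simps)
  moreover have "real (t - 1) / t = 1 - x" "real t / t = 1" using t by (auto simp: x_def field_simps)
  ultimately have less: "Digamma (real 1 / t) - Digamma (real t / t)
      < real k * (Digamma (real (t - 1) / t) - Digamma (real t / t))"
    by (simp only: of_nat_1 x_def[symmetric])
  have "[k * 1 = t - 1] (mod t)"
  proof -
    have "k = t - 1 + (m - 1) * t" using assms by (cases m) auto
    then show ?thesis by (simp add: cong_def)
  qed
  then show ?thesis
    using assms t less by (intro succ_kt_if_Digamma_less[of k t t "t - 1" t 1]) (auto simp: cong_def)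
qed

text \<open>
  In the range \<open>t / 2 < k < t\<close> the residue \<open>k\<close> comes last, since it loses its leading term \<open>1 / k\<close>
  and no other residue loses one. Hence distinct such \<open>k\<close> induce distinct orderings.
\<close>
lemma succ_kt_self:
  assumes "coprime k t" "2 \<le> k" "t < 2 * k" "k < t" "1 \<le> r" "r \<le> t" "r \<noteq> k"
  shows "succ_kt k t r k"
proof -
  obtain r' where r': "r' \<in> {1..t}" "[k * r' = r] (mod t)"
    using assms obtain_residue_quotient[of k t r] by auto
  have t: "0 < real t" using assms by simp
  \<comment> \<open>The quotient of the residue \<open>k\<close> is 1. If \<open>r < k\<close>, the
    left side is at most 0 and the right side is positive.\<close>
  have "Digamma (real 1 / t) - Digamma (real r' / t) < real k * (Digamma (real k / t) - Digamma (real r / t))"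
  proof (cases "r < k")
    case True
    have "Digamma (real 1 / t) \<le> Digamma (real r' / t)"
      using r' t by (intro Digamma_real_mono) (auto simp: divide_right_mono)
    moreover have "Digamma (real r / t) < Digamma (real k / t)"
      using True assms by (intro Digamma_real_strict_mono) (auto simp: divide_strict_right_mono)
    ultimately show ?thesis using assms
      by (smt (verit) mult_pos_pos of_nat_0_less_iff less_le_trans zero_less_numeral)
  next
    case False
    then have "k < r" using assms by simp
    define a where "a = real k / t"
    define b where "b = real r / t"
    have ab: "1 / 2 < a" "a < b" "b \<le> 1"
      using assms \<open>k < r\<close> t by (auto simp: a_def b_def field_simps)
    \<comment> \<open>The comparison series telescopes to \<open>Digamma 2 - Digamma 1 = 1\<close>.
      It dominates because \<open>a\<close> and \<open>b\<close> exceed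
      \<open>1 / 2\<close>.\<close>
    have "Digamma (b + 1) - Digamma (a + 1) \<le> b - a"
    proof -
      have "(\<lambda>n. (b - a) * (1 / (1 + real n) - 1 / (2 + real n))) sums ((b - a) * (Digamma 2 - Digamma 1))"
        by (intro sums_mult Digamma_diff_sums) auto
      moreover have "Digamma 2 - Digamma 1 = (1 :: real)"
        using Digamma_plus1[of "1 :: real"] by simp
      moreover have "1 / (a + 1 + real n) - 1 / (b + 1 + real n)
          \<le> (b - a) * (1 / (1 + real n) - 1 / (2 + real n))" for n
      proof -
        have "1 / (a + 1 + real n) - 1 / (b + 1 + real n) = (b - a) / ((a + 1 + n) * (b + 1 + n))"
          using ab reciprocal_diff[of "a + 1" "b - a" n] by (simp add: add.commute add.left_commute)
        also have "\<dots> \<le> (b - a) / ((1 + real n) * (2 + real n))"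
        proof (intro divide_left_mono mult_pos_pos)
          have "(1 + real n) * (2 + real n) \<le> (3 / 2 + real n) * (3 / 2 + real n)"
            by (simp add: algebra_simps)
          also have "\<dots> \<le> (a + 1 + n) * (b + 1 + n)" using ab by (intro mult_mono) auto
          finally show "(1 + real n) * (2 + real n) \<le> (a + 1 + n) * (b + 1 + n)" .
        qed (use ab in auto)
        also have "\<dots> = (b - a) * (1 / (1 + real n) - 1 / (2 + real n))"
          by (simp add: field_simps)
        finally show ?thesis .
      qed
      ultimately show ?thesis
        using ab sums_le[OF _ Digamma_diff_sums[of "a + 1" "b + 1"]]
        by (metis (no_types, lifting) add_pos_pos less_trans mult.right_neutral
          zero_less_divide_1_iff zero_less_numeral zero_less_one)
    qed
    then have "real k * (Digamma b - Digamma a) \<le> real k * (1 / a - 1 / b + (b - a))"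
      using ab assms by (intro mult_left_mono) (auto simp: Digamma_plus1)
    also have "\<dots> = t * (1 - a / b + a * (b - a))"
      using ab t by (simp add: a_def field_simps)
    also have "\<dots> < t * (1 - 1 / real r')"
    proof -
      have ab4: "a * (b - a) \<le> 1 / 4"
      proof -
        have "a * (b - a) \<le> a * (1 - a)" using ab by (intro mult_left_mono) auto
        also have "\<dots> \<le> 1 / 4"
          using zero_le_power2[of "a - 1 / 2"] by (simp add: power2_eq_square algebra_simps)
        finally show ?thesis .
      qed
      \<comment> \<open>The goal is \<open>1 / r' + a * (b - a) < a / b\<close>. From
        \<open>r' = 4\<close> on, \<open>1 / 4 + 1 / 4 < a / b\<close> suffices. The quotients 1 and
        2 are impossible for \<open>k < r \<le> t\<close>, and 3 forces
        \<open>r = 3 * k - t\<close>, which raises \<open>a / b\<close> to at least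
        \<open>2 / 3\<close>.\<close>
      consider "r' = 1" | "r' = 2" | "r' = 3" | "4 \<le> r'" using r' by fastforce
      then have "1 - a / b + a * (b - a) < 1 - 1 / real r'"
      proof cases
        case 1
        then have "t dvd r - k" using r'(2) \<open>k < r\<close> by (simp add: cong_altdef_nat cong_sym_eq[of k])
        then show ?thesis using assms \<open>k < r\<close> by (auto dest: dvd_imp_le)
      next
        case 2
        then have "t dvd 2 * k - r" using r'(2) assms by (simp add: cong_altdef_nat mult.commute)
        then show ?thesis using assms \<open>k < r\<close> by (auto dest: dvd_imp_le)
      next
        case 3
        then have "t dvd 3 * k - r" using r'(2) assms by (simp add: cong_altdef_nat mult.commute)
        then obtain j where j: "3 * k - r = t * j" by blast
        have "0 < t * j" "t * j < t * 2" using j[symmetric] assms \<open>k < r\<close> by linarith+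
        then have "j = 1" by simp
        then have "r = 3 * k - t" using j assms by simp
        then have "b = 3 * a - 1" using assms t by (simp add: a_def b_def field_simps)
        then have "2 / 3 \<le> a / b" using ab by (simp add: field_simps)
        then show ?thesis using ab4 3 by simp
      next
        case 4
        have "1 / 2 < a / b" using ab by (simp add: field_simps)
        moreover have "1 / real r' \<le> 1 / 4" using 4 by (simp add: field_simps)
        ultimately show ?thesis using ab4 by linarith
      qed
      then show ?thesis using t by simp
    qed
    also have "t * (1 - 1 / real r') = 1 / (1 / real t) - 1 / (real r' / t)"
      using r' t by (simp add: field_simps)
    also have "\<dots> \<le> Digamma (real r' / t) - Digamma (1 / t)"
      using r' t by (intro Digamma_increment_ge) (auto simp: divide_right_mono)
    finally show ?thesis by (simp add: a_def b_def algebra_simps)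
  qed
  then show ?thesis
    using assms r' by (intro succ_kt_if_Digamma_less[of k t r k r' 1]) auto
qed

section \<open>Counting the orderings\<close>

lemma prec_kt_iff_succ_kt: "prec_kt k t r s \<longleftrightarrow> succ_kt k t s r"
  by (simp add: prec_kt_def succ_kt_def)

lemma succ_kt_asym: "succ_kt k t r s \<Longrightarrow> \<not> succ_kt k t s r"
proof
  assume "succ_kt k t r s" "succ_kt k t s r"
  then have "\<forall>\<^sub>F n in sequentially. False"
    unfolding succ_kt_def by eventually_elim simp
  then show False by simp
qed

text \<open>The reflection of \<open>k\<close> to \<open>t - k\<close> preserves totatives and
  exchanges the two halves; the midpoint is not coprime to \<open>t\<close> when
  \<open>t > 2\<close>.\<close>

lemma totient_le_twice_upper_half:
  assumes "2 < t"
  shows "totient t \<le> 2 * card {k \<in> totatives t. t < 2 * k}"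
proof -
  let ?B = "{k \<in> totatives t. t < 2 * k}"
  have "totatives t \<subseteq> ?B \<union> (\<lambda>k. t - k) ` ?B"
  proof
    fix k assume k: "k \<in> totatives t"
    then have "0 < k" "k \<le> t" "coprime k t" by (auto simp: totatives_def)
    have "2 * k \<noteq> t" using \<open>coprime k t\<close> assms
      by (metis coprime_common_divisor_nat dvd_refl dvd_triv_right mult.commute
          mult_1_right order_less_irrefl)
    have "k \<noteq> t" using \<open>coprime k t\<close> assms by auto
    show "k \<in> ?B \<union> (\<lambda>k. t - k) ` ?B"
    proof (cases "t < 2 * k")
      case False
      have "coprime (t - k) t" using \<open>coprime k t\<close> \<open>k \<le> t\<close>
        by (metis coprime_iff_gcd_eq_1 gcd.commute gcd_diff2_nat)
      then have "t - k \<in> ?B"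
        using False \<open>2 * k \<noteq> t\<close> \<open>k \<noteq> t\<close> \<open>k \<le> t\<close> \<open>0 < k\<close> by (auto simp: totatives_def)
      moreover have "k = t - (t - k)" using \<open>k \<le> t\<close> by simp
      ultimately show ?thesis by blast
    qed (use k in auto)
  qed
  then have "totient t \<le> card (?B \<union> (\<lambda>k. t - k) ` ?B)"
    unfolding totient_def by (intro card_mono) auto
  also have "\<dots> \<le> card ?B + card ((\<lambda>k. t - k) ` ?B)" by (rule card_Un_le)
  also have "\<dots> \<le> 2 * card ?B" using card_image_le[of ?B "\<lambda>k. t - k"] by simp
  finally show ?thesis .
qed

text \<open>If \<open>k\<close> and \<open>l\<close> in the upper half shared an ordering, each
  would lie strictly below the other in it.\<close>

lemma num_orderings_ge:
  assumes "2 < t"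
  shows "totient t \<le> 2 * num_orderings t"
proof -
  let ?B = "{k \<in> totatives t. t < 2 * k}"
  have B: "coprime k t" "2 \<le> k" "t < 2 * k" "k < t" if "k \<in> ?B" for k
  proof -
    have "k \<noteq> t" using that assms by (auto simp: totatives_def)
    then show "coprime k t" "2 \<le> k" "t < 2 * k" "k < t"
      using that assms by (auto simp: totatives_def)
  qed
  have "card ?B \<le> num_orderings t"
    unfolding num_orderings_def
  proof (rule card_inj_on_le)
    show "inj_on (\<lambda>k. ordering_kt k t) ?B"
    proof (rule inj_onI, rule ccontr)
      fix k l assume kl: "k \<in> ?B" "l \<in> ?B" "ordering_kt k t = ordering_kt l t" "k \<noteq> l"
      have "succ_kt k t l k" "succ_kt l t k l"
        using B[OF kl(1)] B[OF kl(2)] kl(4) by (auto intro!: succ_kt_self)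
      then have "(k, l) \<in> ordering_kt k t" "(l, k) \<in> ordering_kt l t"
        using B[OF kl(1)] B[OF kl(2)] by (auto simp: ordering_kt_def prec_kt_iff_succ_kt)
      then show False
        using kl(3) succ_kt_asym[of k t l k] by (auto simp: ordering_kt_def prec_kt_iff_succ_kt)
    qed
    show "(\<lambda>k. ordering_kt k t) ` ?B \<subseteq> {ordering_kt k t |k. 2 \<le> k \<and> coprime k t}"
      using B by blast
    \<comment> \<open>Finiteness is essential for the comparison, as \<open>card\<close> of an
      infinite set is 0.\<close>
    show "finite {ordering_kt k t |k. 2 \<le> k \<and> coprime k t}"
      by (rule finite_subset[of _ "Pow ({1..t} \<times> {1..t})"]) (auto simp: ordering_kt_def)
  qed
  then show ?thesis using totient_le_twice_upper_half[OF assms] by linarith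
qed

theorem theorem1p6:
  fixes k t :: nat
  assumes "2 \<le> k" and "2 \<le> t" and "coprime k t"
  shows "(\<forall>r. 1 \<le> r \<and> r + k \<le> t \<longrightarrow> succ_kt k t r (r + k))
    \<and> (\<forall>r y s. 1 \<le> r \<and> r \<le> y \<and> y \<le> t \<and> r < s \<and> s \<le> t \<and> y * (y + 1) \<le> k
          \<longrightarrow> succ_kt k t r s)
    \<and> (2 \<le> k \<longrightarrow> (\<forall>s. 2 \<le> s \<and> s \<le> t \<longrightarrow> succ_kt k t 1 s))
    \<and> (real k \<ge> 6 * (real t ^ 2 - 1) / pi ^ 2 \<longrightarrow>
          (\<forall>r s. 1 \<le> r \<and> r < s \<and> s \<le> t \<longrightarrow> succ_kt k t r s))
    \<and> (\<forall>m::nat. 1 \<le> m \<and> k = m * t - 1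
          \<and> real k \<le> inverse (pi ^ 2 / 6 + 5 / (2 * real t)) * (real t ^ 2 - 1)
          \<longrightarrow> succ_kt k t t (t - 1))
    \<and> (2 < t \<longrightarrow> real (num_orderings t) \<ge> real (totient t) / 2)"
proof (intro conjI allI impI)
  show "succ_kt k t r (r + k)" if "1 \<le> r \<and> r + k \<le> t" for r
    using that assms by (intro succ_kt_add) auto
  show "succ_kt k t r s"
    if "1 \<le> r \<and> r \<le> y \<and> y \<le> t \<and> r < s \<and> s \<le> t \<and> y * (y + 1) \<le> k" for r y s
  proof (rule succ_kt_if_ge_mult_Suc)
    have "r * (r + 1) \<le> y * (y + 1)" using that by (intro mult_le_mono) auto
    then show "r * (r + 1) \<le> k" using that by linarith
  qed (use that assms in auto)
  show "succ_kt k t 1 s" if "2 \<le> s \<and> s \<le> t" for s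
    using that assms by (intro succ_kt_if_ge_mult_Suc) auto
  show "succ_kt k t r s"
    if "6 * (real t ^ 2 - 1) / pi ^ 2 \<le> real k" "1 \<le> r \<and> r < s \<and> s \<le> t" for r s
    using that assms by (intro succ_kt_if_large) auto
  show "succ_kt k t t (t - 1)" if "1 \<le> m \<and> k = m * t - 1
      \<and> real k \<le> inverse (pi ^ 2 / 6 + 5 / (2 * real t)) * (real t ^ 2 - 1)" for m
    using that assms by (intro succ_kt_last[of k t m]) auto
  show "real (totient t) / 2 \<le> real (num_orderings t)" if "2 < t"
    using num_orderings_ge[OF that] by linarith
qed

end
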